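(* Let $(\mathfrak{A}_1,\theta_1)$ and $(\mathfrak{A}_2,\theta_2)$ be unital $\mathbb{Z}_2$-graded $C^*$-algebras, and let $\omega_1$ be a state on $\mathfrak{A}_1$ and $\omega_2$ a state on $\mathfrak{A}_2$. Then the product functional $\omega_1\times\omega_2$ is positive on the Fermi tensor product $\mathfrak{A}_1\otimes_F\mathfrak{A}_2$ if and only if at least one of $\omega_1$ and $\omega_2$ is even. Moreover, $\omega_1\times\omega_2$ is even if and only if both $\omega_1$ and $\omega_2$ are even.
   Context: A $\mathbb{Z}_2$-graded $C^*$-algebra is a pair $(\mathfrak{A},\theta)$ with $\mathfrak{A}$ a $C^*$-algebra and $\theta$ a $*$-automorphism of $\mathfrak{A}$ with $\theta^2=\mathrm{id}$. Set $\mathfrak{A}_\pm=\{a:\theta(a)=\pm a\}$, so $\mathfrak{A}=\mathfrak{A}_+\oplus\mathfrak{A}_-$; elements of $\mathfrak{A}_+\cup\mathfrak{A}_-$ are homogeneous, with grade $\partial(a)=\pm1$ for $a\in\mathfrak{A}_\pm$. For homogeneous $a,b$ put $\varepsilon(a,b)=-1$ if $\partial(a)=\partial(b)=-1$ and $\varepsilon(a,b)=1$ otherwise. A linear functional is even if it is invariant under the grading automorphism. The Fermi tensor product $\mathfrak{A}_1\otimes_F\mathfrak{A}_2$ is the algebraic tensor product $\mathfrak{A}_1\odot\mathfrak{A}_2$ with product and involution determined on homogeneous elements by $(a_1\otimes a_2)(b_1\otimes b_2)=\varepsilon(a_2,b_1)\,a_1b_1\otimes a_2b_2$ and $(a_1\otimes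 a_2)^*=\varepsilon(a_1,a_2)\,a_1^*\otimes a_2^*$. It is graded by the $*$-automorphism $a_1\otimes a_2\mapsto\theta_1(a_1)\otimes\theta_2(a_2)$. The product functional is the linear functional with $(\omega_1\times\omega_2)(a_1\otimes a_2)=\omega_1(a_1)\omega_2(a_2)$. A linear functional $f$ on a $*$-algebra is positive if $f(x^*x)\ge0$ for all $x$. *)

theory Defs
  imports "HOL-Analysis.Analysis" "HOL-Library.Poly_Mapping" "HOL-Library.Complex_Order"
begin

section \<open>Complex vector spaces\<close>

class complex_vector = ab_group_add +
  fixes scaleC :: "complex \<Rightarrow> 'a \<Rightarrow> 'a"  (infixr \<open>*\<^sub>C\<close> 75)
  assumes scaleC_add_right: "c *\<^sub>C (x + y) = c *\<^sub>C x + c *\<^sub>C y"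
    and scaleC_add_left: "(c + d) *\<^sub>C x = c *\<^sub>C x + d *\<^sub>C x"
    and scaleC_scaleC: "c *\<^sub>C (d *\<^sub>C x) = (c * d) *\<^sub>C x"
    and scaleC_one: "1 *\<^sub>C x = x"

global_interpretation complex_vector: vector_space "scaleC :: complex \<Rightarrow> 'a \<Rightarrow> 'a::complex_vector"
  by unfold_locales (simp_all add: scaleC_add_right scaleC_add_left scaleC_scaleC scaleC_one)

abbreviation clinear :: "('a::complex_vector \<Rightarrow> 'b::complex_vector) \<Rightarrow> bool"
  where "clinear \<equiv> Vector_Spaces.linear scaleC scaleC"

lemma clinear_iff:
  "clinear f \<longleftrightarrow> (\<forall>x y. f (x + y) = f x + f y) \<and> (\<forall>c x. f (c *\<^sub>C x) = c *\<^sub>C f x)"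
  by (auto simp: Vector_Spaces.linear_iff complex_vector.vector_space_axioms)

instantiation complex :: complex_vector
begin
definition "scaleC_complex = ((*) :: complex \<Rightarrow> complex \<Rightarrow> complex)"
instance by standard (simp_all add: scaleC_complex_def algebra_simps)
end

instantiation poly_mapping :: (type, complex_vector) complex_vector
begin
lift_definition scaleC_poly_mapping :: "complex \<Rightarrow> ('a \<Rightarrow>\<^sub>0 'b) \<Rightarrow> 'a \<Rightarrow>\<^sub>0 'b"
  is "\<lambda>c p x. c *\<^sub>C p x"
  by (erule finite_subset[rotated]) auto
instance
  by standard
    (transfer, simp add: scaleC_add_right scaleC_add_left scaleC_scaleC scaleC_one)+
end

lemma lookup_scaleC [simp]: "Poly_Mapping.lookup (c *\<^sub>C p) x = c *\<^sub>C Poly_Mapping.lookup p x"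
  by (transfer) simp

section \<open>Graded C*-algebras, functionals and states\<close>

text \<open>Unital C*-algebras. The sort \<^class>\<open>real_normed_algebra_1\<close> makes the algebra nonzero; this
  is no restriction here, since the zero algebra has no states, and \<open>norm 1 = 1\<close> then follows
  from the C*-identity.\<close>

class unital_cstar_algebra = real_normed_algebra_1 + banach + complex_vector +
  fixes adj :: "'a \<Rightarrow> 'a"
  assumes scaleR_scaleC: "r *\<^sub>R x = complex_of_real r *\<^sub>C x"
    and mult_scaleC_left: "(c *\<^sub>C x) * y = c *\<^sub>C (x * y)"
    and mult_scaleC_right: "x * (c *\<^sub>C y) = c *\<^sub>C (x * y)"
    and norm_scaleC: "norm (c *\<^sub>C x) = cmod c * norm x"
    and adj_add: "adj (x + y) = adj x + adj y"
    and adj_scaleC: "adj (c *\<^sub>C x) = cnj c *\<^sub>C adj x"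
    and adj_mult: "adj (x * y) = adj y * adj x"
    and adj_adj: "adj (adj x) = x"
    and cstar_identity: "norm (adj x * x) = (norm x)\<^sup>2"

instantiation complex :: unital_cstar_algebra
begin
definition "adj_complex = cnj"
instance
  by standard
    (simp_all add: scaleC_complex_def adj_complex_def norm_mult scaleR_conv_of_real power2_eq_square)
end

definition star_automorphism :: "('a::unital_cstar_algebra \<Rightarrow> 'a) \<Rightarrow> bool"
  where "star_automorphism \<theta> \<longleftrightarrow>
    clinear \<theta> \<and> bij \<theta> \<and> (\<forall>a b. \<theta> (a * b) = \<theta> a * \<theta> b) \<and> (\<forall>a. \<theta> (adj a) = adj (\<theta> a))"

definition grading :: "('a::unital_cstar_algebra \<Rightarrow> 'a) \<Rightarrow> bool"
  where "grading \<theta> \<longleftrightarrow> star_automorphism \<theta> \<and> \<theta> \<circ> \<theta> = id"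

text \<open>Grades are the complex numbers \<open>1\<close> and \<open>- 1\<close>.\<close>

definition homogeneous :: "('a::complex_vector \<Rightarrow> 'a) \<Rightarrow> complex \<Rightarrow> 'a \<Rightarrow> bool"
  where "homogeneous \<theta> s a \<longleftrightarrow> s \<in> {1, - 1} \<and> \<theta> a = s *\<^sub>C a"

definition graded_part :: "('a::complex_vector \<Rightarrow> 'a) \<Rightarrow> complex \<Rightarrow> 'a \<Rightarrow> 'a"
  where "graded_part \<theta> s a = (1 / 2) *\<^sub>C (a + s *\<^sub>C \<theta> a)"

definition grade_sign :: "complex \<Rightarrow> complex \<Rightarrow> complex"
  where "grade_sign s t = (if s = - 1 \<and> t = - 1 then - 1 else 1)"

definition even_functional :: "('a::complex_vector \<Rightarrow> 'a) \<Rightarrow> ('a \<Rightarrow> complex) \<Rightarrow> bool"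
  where "even_functional \<theta> f \<longleftrightarrow> (\<forall>a. f (\<theta> a) = f a)"

text \<open>The multiplication and the involution are arguments, because those of the Fermi tensor
  product depend on the gradings and hence cannot be attached to its type. The order on
  \<^typ>\<open>complex\<close> is that of \<^theory>\<open>HOL-Library.Complex_Order\<close>: \<open>0 \<le> z\<close> means that \<open>z\<close> is real
  and nonnegative.\<close>

definition positive_functional ::
    "('a \<Rightarrow> 'a \<Rightarrow> 'a) \<Rightarrow> ('a \<Rightarrow> 'a) \<Rightarrow> ('a::complex_vector \<Rightarrow> complex) \<Rightarrow> bool"
  where "positive_functional mul star f \<longleftrightarrow> clinear f \<and> (\<forall>x. 0 \<le> f (mul (star x) x))"

definition state :: "('a::unital_cstar_algebra \<Rightarrow> complex) \<Rightarrow> bool"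
  where "state \<omega> \<longleftrightarrow> positive_functional (*) adj \<omega> \<and> \<omega> 1 = 1"

section \<open>The algebraic tensor product\<close>

text \<open>The free complex vector space on \<open>A \<times> B\<close> modulo the bilinearity relations.\<close>

definition tensor_relators :: "(('a::complex_vector \<times> 'b::complex_vector) \<Rightarrow>\<^sub>0 complex) set"
  where "tensor_relators =
    {Poly_Mapping.single (a + a', b) 1 - Poly_Mapping.single (a, b) 1
       - Poly_Mapping.single (a', b) 1 | a a' b. True} \<union>
    {Poly_Mapping.single (a, b + b') 1 - Poly_Mapping.single (a, b) 1
       - Poly_Mapping.single (a, b') 1 | a b b'. True} \<union>
    {Poly_Mapping.single (c *\<^sub>C a, b) 1 - c *\<^sub>C Poly_Mapping.single (a, b) 1 | c a b. True} \<union>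
    {Poly_Mapping.single (a, c *\<^sub>C b) 1 - c *\<^sub>C Poly_Mapping.single (a, b) 1 | c a b. True}"

definition tensor_eq ::
    "(('a::complex_vector \<times> 'b::complex_vector) \<Rightarrow>\<^sub>0 complex) \<Rightarrow> (('a \<times> 'b) \<Rightarrow>\<^sub>0 complex) \<Rightarrow> bool"
  where "tensor_eq p q \<longleftrightarrow> p - q \<in> complex_vector.span tensor_relators"

lemma equivp_tensor_eq: "equivp tensor_eq"
proof (rule equivpI)
  show "reflp tensor_eq"
    by (auto simp: reflp_def tensor_eq_def complex_vector.span_zero)
  show "symp tensor_eq"
    by (rule sympI) (auto simp: tensor_eq_def dest: complex_vector.span_neg)
  show "transp tensor_eq"
    by (rule transpI) (auto simp: tensor_eq_def dest: complex_vector.span_add)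
qed

quotient_type (overloaded) ('a, 'b) tensor =
  "('a::complex_vector \<times> 'b::complex_vector) \<Rightarrow>\<^sub>0 complex" / tensor_eq
  by (rule equivp_tensor_eq)

lemma tensor_eq_cong:
  assumes "tensor_eq p q"
  shows "tensor_eq p' q' \<Longrightarrow> tensor_eq (p + p') (q + q')"
    and "tensor_eq p' q' \<Longrightarrow> tensor_eq (p - p') (q - q')"
    and "tensor_eq (- p) (- q)"
    and "tensor_eq (c *\<^sub>C p) (c *\<^sub>C q)"
proof -
  have eq: "p + p' - (q + q') = (p - q) + (p' - q')" "p - p' - (q - q') = (p - q) - (p' - q')"
    "- p - - q = - (p - q)" "c *\<^sub>C p - c *\<^sub>C q = c *\<^sub>C (p - q)"
    by (simp_all add: complex_vector.scale_right_diff_distrib)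
  show "tensor_eq p' q' \<Longrightarrow> tensor_eq (p + p') (q + q')"
    "tensor_eq p' q' \<Longrightarrow> tensor_eq (p - p') (q - q')"
    "tensor_eq (- p) (- q)" "tensor_eq (c *\<^sub>C p) (c *\<^sub>C q)"
    using assms unfolding tensor_eq_def eq
    by (simp_all only: complex_vector.span_add complex_vector.span_diff
        complex_vector.span_neg complex_vector.span_scale)
qed

instantiation tensor :: (complex_vector, complex_vector) complex_vector
begin

lift_definition zero_tensor :: "('a, 'b) tensor" is 0 .

lift_definition plus_tensor :: "('a, 'b) tensor \<Rightarrow> ('a, 'b) tensor \<Rightarrow> ('a, 'b) tensor" is "(+)"
  by (drule (1) tensor_eq_cong(1))

lift_definition minus_tensor :: "('a, 'b) tensor \<Rightarrow> ('a, 'b) tensor \<Rightarrow> ('a, 'b) tensor" is "(-)"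
  by (drule (1) tensor_eq_cong(2))

lift_definition uminus_tensor :: "('a, 'b) tensor \<Rightarrow> ('a, 'b) tensor" is "uminus"
  by (drule tensor_eq_cong(3))

lift_definition scaleC_tensor :: "complex \<Rightarrow> ('a, 'b) tensor \<Rightarrow> ('a, 'b) tensor" is "scaleC"
  by (rule tensor_eq_cong(4))

instance
  by standard
    (transfer, simp add: tensor_eq_def complex_vector.span_zero algebra_simps
      scaleC_add_right scaleC_add_left scaleC_scaleC scaleC_one)+

end

lift_definition tensor_op :: "'a::complex_vector \<Rightarrow> 'b::complex_vector \<Rightarrow> ('a, 'b) tensor"
    (infixr \<open>\<otimes>\<close> 70)
  is "\<lambda>a b. Poly_Mapping.single (a, b) 1" .

lemma tensor_add_left: "(a + a') \<otimes> b = a \<otimes> b + a' \<otimes> b"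
proof transfer
  fix a a' :: 'a and b :: 'b
  have "Poly_Mapping.single (a + a', b) 1 - Poly_Mapping.single (a, b) 1
      - Poly_Mapping.single (a', b) (1::complex) \<in> tensor_relators"
    unfolding tensor_relators_def by blast
  then show "tensor_eq (Poly_Mapping.single (a + a', b) 1)
      (Poly_Mapping.single (a, b) 1 + Poly_Mapping.single (a', b) 1)"
    unfolding tensor_eq_def by (simp add: complex_vector.span_base diff_diff_eq)
qed

lemma tensor_add_right: "a \<otimes> (b + b') = a \<otimes> b + a \<otimes> b'"
proof transfer
  fix a :: 'a and b b' :: 'b
  have "Poly_Mapping.single (a, b + b') 1 - Poly_Mapping.single (a, b) 1
      - Poly_Mapping.single (a, b') (1::complex) \<in> tensor_relators"
    unfolding tensor_relators_def by blast
  then show "tensor_eq (Poly_Mapping.single (a, b + b') 1)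
      (Poly_Mapping.single (a, b) 1 + Poly_Mapping.single (a, b') 1)"
    unfolding tensor_eq_def by (simp add: complex_vector.span_base diff_diff_eq)
qed

lemma tensor_scaleC_left: "(c *\<^sub>C a) \<otimes> b = c *\<^sub>C (a \<otimes> b)"
proof transfer
  fix c and a :: 'a and b :: 'b
  have "Poly_Mapping.single (c *\<^sub>C a, b) 1 - c *\<^sub>C Poly_Mapping.single (a, b) 1
      \<in> tensor_relators"
    unfolding tensor_relators_def by blast
  then show "tensor_eq (Poly_Mapping.single (c *\<^sub>C a, b) 1) (c *\<^sub>C Poly_Mapping.single (a, b) 1)"
    unfolding tensor_eq_def by (rule complex_vector.span_base)
qed

lemma tensor_scaleC_right: "a \<otimes> (c *\<^sub>C b) = c *\<^sub>C (a \<otimes> b)"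
proof transfer
  fix c and a :: 'a and b :: 'b
  have "Poly_Mapping.single (a, c *\<^sub>C b) 1 - c *\<^sub>C Poly_Mapping.single (a, b) 1
      \<in> tensor_relators"
    unfolding tensor_relators_def by blast
  then show "tensor_eq (Poly_Mapping.single (a, c *\<^sub>C b) 1) (c *\<^sub>C Poly_Mapping.single (a, b) 1)"
    unfolding tensor_eq_def by (rule complex_vector.span_base)
qed

lemma tensor_induct [case_names add scaleC elem]:
  assumes add: "\<And>x y. P x \<Longrightarrow> P y \<Longrightarrow> P (x + y)"
    and scaleC: "\<And>c x. P x \<Longrightarrow> P (c *\<^sub>C x)"
    and elem: "\<And>a b. P (a \<otimes> b)"
  shows "P x"
proof -
  have zero: "P 0"
    using scaleC[OF elem, of 0] by simp
  have "P (abs_tensor p)" for p :: "('a \<times> 'b) \<Rightarrow>\<^sub>0 complex"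
  proof (induction p rule: update_induct)
    case const
    then show ?case using zero by (simp add: zero_tensor.abs_eq)
  next
    case (update p k v)
    obtain a b where k: "k = (a, b)" by force
    have "Poly_Mapping.update k v p = p + v *\<^sub>C Poly_Mapping.single (a, b) 1"
      using update(1)
      by (auto simp: k poly_mapping_eq_iff fun_eq_iff lookup_add lookup_update lookup_single
          in_keys_iff scaleC_complex_def when_def)
    then have "abs_tensor (Poly_Mapping.update k v p) = abs_tensor p + v *\<^sub>C (a \<otimes> b)"
      by (simp add: plus_tensor.abs_eq tensor_op.abs_eq scaleC_tensor.abs_eq)
    then show ?case using add scaleC elem update by simp
  qed
  then show ?thesis by (induction x) auto
qed

subsection \<open>Lifting balanced maps\<close>

text \<open>Biadditive maps that are balanced over the scalars factor through the tensor product. This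
  covers bilinear as well as biantilinear maps; the latter are needed for the involution.\<close>

definition balanced :: "('a::complex_vector \<Rightarrow> 'b::complex_vector \<Rightarrow> 'c::ab_group_add) \<Rightarrow> bool"
  where "balanced \<beta> \<longleftrightarrow> (\<forall>a a' b. \<beta> (a + a') b = \<beta> a b + \<beta> a' b) \<and>
    (\<forall>a b b'. \<beta> a (b + b') = \<beta> a b + \<beta> a b') \<and> (\<forall>c a b. \<beta> (c *\<^sub>C a) b = \<beta> a (c *\<^sub>C b))"

definition free_lift :: "('a::complex_vector \<Rightarrow> 'b::complex_vector \<Rightarrow> 'c::ab_group_add) \<Rightarrow>
    (('a \<times> 'b) \<Rightarrow>\<^sub>0 complex) \<Rightarrow> 'c"
  where "free_lift \<beta> p =
    (\<Sum>(a, b)\<in>Poly_Mapping.keys p. \<beta> (Poly_Mapping.lookup p (a, b) *\<^sub>C a) b)"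

definition tensor_lift :: "('a::complex_vector \<Rightarrow> 'b::complex_vector \<Rightarrow> 'c::ab_group_add) \<Rightarrow>
    ('a, 'b) tensor \<Rightarrow> 'c"
  where "tensor_lift \<beta> x = free_lift \<beta> (rep_tensor x)"

lemma balancedI:
  assumes "\<And>a a' b. \<beta> (a + a') b = \<beta> a b + \<beta> a' b"
    and "\<And>a b b'. \<beta> a (b + b') = \<beta> a b + \<beta> a b'"
    and "\<And>c a b. \<beta> (c *\<^sub>C a) b = \<beta> a (c *\<^sub>C b)"
  shows "balanced \<beta>"
  using assms by (simp add: balanced_def)

lemma balancedD:
  assumes "balanced \<beta>"
  shows "\<beta> (a + a') b = \<beta> a b + \<beta> a' b" "\<beta> a (b + b') = \<beta> a b + \<beta> a b'"
    "\<beta> (c *\<^sub>C a) b = \<beta> a (c *\<^sub>C b)" "\<beta> 0 b = 0"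
proof -
  show "\<beta> (a + a') b = \<beta> a b + \<beta> a' b" "\<beta> a (b + b') = \<beta> a b + \<beta> a b'"
    "\<beta> (c *\<^sub>C a) b = \<beta> a (c *\<^sub>C b)"
    using assms by (simp_all add: balanced_def)
  have "\<beta> (0 + 0) b = \<beta> 0 b + \<beta> 0 b"
    using assms unfolding balanced_def by blast
  then show "\<beta> 0 b = 0" by simp
qed

lemma free_lift_superset:
  assumes "balanced \<beta>" "finite S" "Poly_Mapping.keys p \<subseteq> S"
  shows "free_lift \<beta> p = (\<Sum>(a, b)\<in>S. \<beta> (Poly_Mapping.lookup p (a, b) *\<^sub>C a) b)"
  unfolding free_lift_def
  by (rule sum.mono_neutral_left[OF assms(2,3)])
    (auto simp: in_keys_iff balancedD(4)[OF assms(1)])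

lemma free_lift_add:
  assumes "balanced \<beta>"
  shows "free_lift \<beta> (p + q) = free_lift \<beta> p + free_lift \<beta> q"
proof -
  let ?S = "Poly_Mapping.keys p \<union> Poly_Mapping.keys q"
  have S: "finite ?S" by simp
  have "free_lift \<beta> (p + q) = (\<Sum>(a, b)\<in>?S. \<beta> (Poly_Mapping.lookup (p + q) (a, b) *\<^sub>C a) b)"
    by (rule free_lift_superset[OF assms S Poly_Mapping.keys_add])
  also have "\<dots> = (\<Sum>(a, b)\<in>?S. \<beta> (Poly_Mapping.lookup p (a, b) *\<^sub>C a) b)
      + (\<Sum>(a, b)\<in>?S. \<beta> (Poly_Mapping.lookup q (a, b) *\<^sub>C a) b)"
    by (simp add: lookup_add scaleC_add_left balancedD(1)[OF assms] sum.distrib case_prod_unfold)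
  also have "\<dots> = free_lift \<beta> p + free_lift \<beta> q"
    using free_lift_superset[OF assms S, of p] free_lift_superset[OF assms S, of q] by auto
  finally show ?thesis .
qed

lemma free_lift_diff:
  assumes "balanced \<beta>"
  shows "free_lift \<beta> (p - q) = free_lift \<beta> p - free_lift \<beta> q"
  using free_lift_add[OF assms, of "p - q" q] by simp

lemma free_lift_scaleC:
  assumes "balanced \<beta>"
  shows "free_lift \<beta> (c *\<^sub>C p) = free_lift (\<lambda>a. \<beta> (c *\<^sub>C a)) p"
proof -
  have "Poly_Mapping.keys (c *\<^sub>C p) \<subseteq> Poly_Mapping.keys p"
    by (auto simp: in_keys_iff)
  then have "free_lift \<beta> (c *\<^sub>C p) =
      (\<Sum>(a, b)\<in>Poly_Mapping.keys p. \<beta> (Poly_Mapping.lookup (c *\<^sub>C p) (a, b) *\<^sub>C a) b)"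
    by (intro free_lift_superset[OF assms]) auto
  then show ?thesis
    by (simp add: free_lift_def scaleC_complex_def scaleC_scaleC)
qed

lemma free_lift_single:
  assumes "balanced \<beta>"
  shows "free_lift \<beta> (Poly_Mapping.single (a, b) c) = \<beta> (c *\<^sub>C a) b"
  by (cases "c = 0") (simp_all add: free_lift_def balancedD(4)[OF assms])

lemma balanced_scaleC:
  assumes "balanced \<beta>"
  shows "balanced (\<lambda>a. \<beta> (c *\<^sub>C a))"
proof (rule balancedI)
  show "\<beta> (c *\<^sub>C d *\<^sub>C a) b = \<beta> (c *\<^sub>C a) (d *\<^sub>C b)" for d a b
    by (metis balancedD(3)[OF assms] scaleC_scaleC mult.commute)
qed (simp_all add: scaleC_add_right balancedD[OF assms])

lemma free_lift_relators:
  assumes "balanced \<beta>" "p \<in> tensor_relators"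
  shows "free_lift \<beta> p = 0"
  using assms(2) unfolding tensor_relators_def
  by (auto simp: free_lift_diff[OF assms(1)] free_lift_single[OF assms(1)]
      free_lift_scaleC[OF assms(1)] free_lift_single[OF balanced_scaleC[OF assms(1)]]
      balancedD[OF assms(1)] scaleC_one scaleC_add_right)

lemma free_lift_span:
  assumes "p \<in> complex_vector.span tensor_relators" "balanced \<beta>"
  shows "free_lift \<beta> p = 0"
  using assms
proof (induction arbitrary: \<beta> rule: complex_vector.span_induct_alt)
  case base
  then show ?case by (simp add: free_lift_def)
next
  case (step c x y)
  then show ?case
    by (simp add: free_lift_add free_lift_scaleC free_lift_relators[OF balanced_scaleC])
qed

lemma tensor_lift_abs:
  assumes "balanced \<beta>"
  shows "tensor_lift \<beta> (abs_tensor p) = free_lift \<beta> p"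
proof -
  have "tensor_eq (rep_tensor (abs_tensor p)) p"
    by (metis Quotient3_tensor equivp_tensor_eq equivp_reflp rep_abs_rsp_left)
  then have "free_lift \<beta> (rep_tensor (abs_tensor p) - p) = 0"
    unfolding tensor_eq_def by (rule free_lift_span[OF _ assms])
  then show ?thesis
    by (simp add: tensor_lift_def free_lift_diff[OF assms])
qed

lemma tensor_lift_elem [simp]:
  assumes "balanced \<beta>"
  shows "tensor_lift \<beta> (a \<otimes> b) = \<beta> a b"
  by (simp add: tensor_op.abs_eq tensor_lift_abs[OF assms] free_lift_single[OF assms] scaleC_one)

lemma tensor_lift_add:
  assumes "balanced \<beta>"
  shows "tensor_lift \<beta> (x + y) = tensor_lift \<beta> x + tensor_lift \<beta> y"
proof -
  obtain p q where "x = abs_tensor p" "y = abs_tensor q"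
    by (metis Quotient3_abs_rep[OF Quotient3_tensor])
  then show ?thesis
    by (simp add: plus_tensor.abs_eq tensor_lift_abs[OF assms] free_lift_add[OF assms])
qed

lemma tensor_lift_scaleC:
  assumes "balanced \<beta>"
  shows "tensor_lift \<beta> (c *\<^sub>C x) = tensor_lift (\<lambda>a. \<beta> (c *\<^sub>C a)) x"
proof -
  obtain p where "x = abs_tensor p"
    by (metis Quotient3_abs_rep[OF Quotient3_tensor])
  then show ?thesis
    by (simp add: scaleC_tensor.abs_eq tensor_lift_abs[OF assms] free_lift_scaleC[OF assms]
        tensor_lift_abs[OF balanced_scaleC[OF assms]])
qed

lemma tensor_lift_fun_add:
  "tensor_lift (\<lambda>a b. \<beta> a b + \<gamma> a b) x = tensor_lift \<beta> x + tensor_lift \<gamma> x"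
  by (simp add: tensor_lift_def free_lift_def sum.distrib case_prod_unfold)

lemma tensor_lift_fun_scaleC:
  "tensor_lift (\<lambda>a b. c *\<^sub>C \<beta> a b) x = c *\<^sub>C tensor_lift \<beta> x"
  by (simp add: tensor_lift_def free_lift_def complex_vector.scale_sum_right case_prod_unfold)

section \<open>The Fermi tensor product\<close>

text \<open>Both operations are given by their formulas on homogeneous elements, extended to arbitrary
  elementary tensors by decomposing the factors into their graded parts, and then to the whole
  tensor product by (bi)linearity and antilinearity.\<close>

definition fermi_mult_elem :: "('a::unital_cstar_algebra \<Rightarrow> 'a) \<Rightarrow> ('b::unital_cstar_algebra \<Rightarrow> 'b) \<Rightarrow>
    'a \<Rightarrow> 'b \<Rightarrow> 'a \<Rightarrow> 'b \<Rightarrow> ('a, 'b) tensor"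
  where "fermi_mult_elem \<theta>\<^sub>1 \<theta>\<^sub>2 a\<^sub>1 a\<^sub>2 b\<^sub>1 b\<^sub>2 =
    (\<Sum>s\<in>{1, - 1}. \<Sum>t\<in>{1, - 1}. grade_sign s t *\<^sub>C
      ((a\<^sub>1 * graded_part \<theta>\<^sub>1 t b\<^sub>1) \<otimes> (graded_part \<theta>\<^sub>2 s a\<^sub>2 * b\<^sub>2)))"

definition fermi_mult :: "('a::unital_cstar_algebra \<Rightarrow> 'a) \<Rightarrow> ('b::unital_cstar_algebra \<Rightarrow> 'b) \<Rightarrow>
    ('a, 'b) tensor \<Rightarrow> ('a, 'b) tensor \<Rightarrow> ('a, 'b) tensor"
  where "fermi_mult \<theta>\<^sub>1 \<theta>\<^sub>2 x y =
    tensor_lift (\<lambda>a\<^sub>1 a\<^sub>2. tensor_lift (fermi_mult_elem \<theta>\<^sub>1 \<theta>\<^sub>2 a\<^sub>1 a\<^sub>2) y) x"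

definition fermi_star :: "('a::unital_cstar_algebra \<Rightarrow> 'a) \<Rightarrow> ('b::unital_cstar_algebra \<Rightarrow> 'b) \<Rightarrow>
    ('a, 'b) tensor \<Rightarrow> ('a, 'b) tensor"
  where "fermi_star \<theta>\<^sub>1 \<theta>\<^sub>2 = tensor_lift (\<lambda>a\<^sub>1 a\<^sub>2. \<Sum>s\<in>{1, - 1}. \<Sum>t\<in>{1, - 1}.
    grade_sign s t *\<^sub>C (adj (graded_part \<theta>\<^sub>1 s a\<^sub>1) \<otimes> adj (graded_part \<theta>\<^sub>2 t a\<^sub>2)))"

definition fermi_grading :: "('a::unital_cstar_algebra \<Rightarrow> 'a) \<Rightarrow> ('b::unital_cstar_algebra \<Rightarrow> 'b) \<Rightarrow>
    ('a, 'b) tensor \<Rightarrow> ('a, 'b) tensor"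
  where "fermi_grading \<theta>\<^sub>1 \<theta>\<^sub>2 = tensor_lift (\<lambda>a\<^sub>1 a\<^sub>2. \<theta>\<^sub>1 a\<^sub>1 \<otimes> \<theta>\<^sub>2 a\<^sub>2)"

definition product_functional :: "('a::complex_vector \<Rightarrow> complex) \<Rightarrow> ('b::complex_vector \<Rightarrow> complex) \<Rightarrow>
    ('a, 'b) tensor \<Rightarrow> complex"
  where "product_functional \<omega>\<^sub>1 \<omega>\<^sub>2 = tensor_lift (\<lambda>a\<^sub>1 a\<^sub>2. \<omega>\<^sub>1 a\<^sub>1 * \<omega>\<^sub>2 a\<^sub>2)"

text \<open>The facts below confirm that these operations are linear (the involution antilinear) and take
  the prescribed values on elementary tensors; by \<open>tensor_induct\<close> this determines them.\<close>

lemma grading_linear: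
  assumes "grading \<theta>"
  shows "\<theta> (a + b) = \<theta> a + \<theta> b" "\<theta> (c *\<^sub>C a) = c *\<^sub>C \<theta> a"
  using assms by (auto simp: grading_def star_automorphism_def clinear_iff)

lemma graded_part_linear:
  assumes "grading \<theta>"
  shows "graded_part \<theta> s (a + b) = graded_part \<theta> s a + graded_part \<theta> s b"
    "graded_part \<theta> s (c *\<^sub>C a) = c *\<^sub>C graded_part \<theta> s a"
  by (simp_all add: graded_part_def grading_linear[OF assms] scaleC_add_right scaleC_scaleC
      algebra_simps)

lemma graded_part_homogeneous:
  assumes "homogeneous \<theta> s a" "t \<in> {1, - 1}"
  shows "graded_part \<theta> t a = (if t = s then a else 0)"
proof -
  have "graded_part \<theta> t a = ((1 + t * s) / 2) *\<^sub>C a"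
    using assms(1)
    by (simp add: graded_part_def homogeneous_def scaleC_scaleC scaleC_add_right add_divide_distrib
        scaleC_add_left)
  moreover have "s \<in> {1, - 1}"
    using assms(1) by (simp add: homogeneous_def)
  ultimately show ?thesis
    using assms(2) by (auto simp: scaleC_one)
qed

lemmas tensor_bilinear =
  tensor_add_left tensor_add_right tensor_scaleC_left tensor_scaleC_right

lemma balanced_fermi_mult_elem:
  assumes "grading \<theta>\<^sub>1" "grading \<theta>\<^sub>2"
  shows "balanced (fermi_mult_elem \<theta>\<^sub>1 \<theta>\<^sub>2 a\<^sub>1 a\<^sub>2)"
  by (rule balancedI)
    (simp_all add: fermi_mult_elem_def graded_part_linear assms distrib_left tensor_bilinear
      mult_scaleC_left mult_scaleC_right scaleC_add_right add_ac)

lemma balanced_fermi_mult: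
  assumes "grading \<theta>\<^sub>1" "grading \<theta>\<^sub>2"
  shows "balanced (\<lambda>a\<^sub>1 a\<^sub>2. tensor_lift (fermi_mult_elem \<theta>\<^sub>1 \<theta>\<^sub>2 a\<^sub>1 a\<^sub>2) y)"
proof -
  have *: "fermi_mult_elem \<theta>\<^sub>1 \<theta>\<^sub>2 (a + a') a\<^sub>2 =
        (\<lambda>b\<^sub>1 b\<^sub>2. fermi_mult_elem \<theta>\<^sub>1 \<theta>\<^sub>2 a a\<^sub>2 b\<^sub>1 b\<^sub>2 + fermi_mult_elem \<theta>\<^sub>1 \<theta>\<^sub>2 a' a\<^sub>2 b\<^sub>1 b\<^sub>2)"
      "fermi_mult_elem \<theta>\<^sub>1 \<theta>\<^sub>2 a (b + b') =
        (\<lambda>b\<^sub>1 b\<^sub>2. fermi_mult_elem \<theta>\<^sub>1 \<theta>\<^sub>2 a b b\<^sub>1 b\<^sub>2 + fermi_mult_elem \<theta>\<^sub>1 \<theta>\<^sub>2 a b' b\<^sub>1 b\<^sub>2)"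
      "fermi_mult_elem \<theta>\<^sub>1 \<theta>\<^sub>2 (c *\<^sub>C a) b = fermi_mult_elem \<theta>\<^sub>1 \<theta>\<^sub>2 a (c *\<^sub>C b)" for a a' a\<^sub>2 b b' c
    by (intro ext, simp add: fermi_mult_elem_def graded_part_linear assms distrib_right
        tensor_bilinear mult_scaleC_left mult_scaleC_right scaleC_add_right add_ac)+
  show ?thesis
    by (rule balancedI) (simp_all add: * tensor_lift_fun_add)
qed

lemma fermi_mult_linear:
  assumes "grading \<theta>\<^sub>1" "grading \<theta>\<^sub>2"
  shows "clinear (\<lambda>x. fermi_mult \<theta>\<^sub>1 \<theta>\<^sub>2 x y)" "clinear (fermi_mult \<theta>\<^sub>1 \<theta>\<^sub>2 x)"
proof -
  have l: "fermi_mult_elem \<theta>\<^sub>1 \<theta>\<^sub>2 (c *\<^sub>C a) b = (\<lambda>b\<^sub>1 b\<^sub>2. c *\<^sub>C fermi_mult_elem \<theta>\<^sub>1 \<theta>\<^sub>2 a b b\<^sub>1 b\<^sub>2)"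
    and r: "fermi_mult_elem \<theta>\<^sub>1 \<theta>\<^sub>2 a b (c *\<^sub>C d) = (\<lambda>b\<^sub>2. c *\<^sub>C fermi_mult_elem \<theta>\<^sub>1 \<theta>\<^sub>2 a b d b\<^sub>2)"
    for a b c d
    by (intro ext, simp add: fermi_mult_elem_def graded_part_linear assms tensor_bilinear
        mult_scaleC_left mult_scaleC_right scaleC_add_right scaleC_scaleC mult.commute)+
  show "clinear (\<lambda>x. fermi_mult \<theta>\<^sub>1 \<theta>\<^sub>2 x y)"
    by (simp add: clinear_iff fermi_mult_def tensor_lift_add balanced_fermi_mult assms
        tensor_lift_scaleC l tensor_lift_fun_scaleC)
  show "clinear (fermi_mult \<theta>\<^sub>1 \<theta>\<^sub>2 x)"
    by (simp add: clinear_iff fermi_mult_def tensor_lift_add balanced_fermi_mult_elem assms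
        tensor_lift_scaleC r tensor_lift_fun_add tensor_lift_fun_scaleC)
qed

lemma fermi_mult_homogeneous:
  assumes "grading \<theta>\<^sub>1" "grading \<theta>\<^sub>2" "homogeneous \<theta>\<^sub>2 s a\<^sub>2" "homogeneous \<theta>\<^sub>1 t b\<^sub>1"
  shows "fermi_mult \<theta>\<^sub>1 \<theta>\<^sub>2 (a\<^sub>1 \<otimes> a\<^sub>2) (b\<^sub>1 \<otimes> b\<^sub>2) = grade_sign s t *\<^sub>C ((a\<^sub>1 * b\<^sub>1) \<otimes> (a\<^sub>2 * b\<^sub>2))"
proof -
  have z: "0 \<otimes> b = 0" "a \<otimes> 0 = 0" for a :: 'a and b :: 'b
    using tensor_scaleC_left[of 0 0 b] tensor_scaleC_right[of a 0 0] by simp_all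
  have "s \<in> {1, - 1}" "t \<in> {1, - 1}"
    using assms(3,4) by (auto simp: homogeneous_def)
  then show ?thesis
    unfolding fermi_mult_def tensor_lift_elem[OF balanced_fermi_mult[OF assms(1,2)]]
    unfolding tensor_lift_elem[OF balanced_fermi_mult_elem[OF assms(1,2)]]
    by (auto simp: fermi_mult_elem_def graded_part_homogeneous[OF assms(3)]
        graded_part_homogeneous[OF assms(4)] z)
qed

lemma balanced_fermi_star:
  assumes "grading \<theta>\<^sub>1" "grading \<theta>\<^sub>2"
  shows "balanced (\<lambda>a\<^sub>1 a\<^sub>2. \<Sum>s\<in>{1, - 1}. \<Sum>t\<in>{1, - 1}.
    grade_sign s t *\<^sub>C (adj (graded_part \<theta>\<^sub>1 s a\<^sub>1) \<otimes> adj (graded_part \<theta>\<^sub>2 t a\<^sub>2)))"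
  by (rule balancedI)
    (simp_all add: graded_part_linear assms tensor_bilinear adj_add adj_scaleC scaleC_add_right add_ac)

lemma fermi_star_antilinear:
  assumes "grading \<theta>\<^sub>1" "grading \<theta>\<^sub>2"
  shows "fermi_star \<theta>\<^sub>1 \<theta>\<^sub>2 (x + y) = fermi_star \<theta>\<^sub>1 \<theta>\<^sub>2 x + fermi_star \<theta>\<^sub>1 \<theta>\<^sub>2 y"
    and "fermi_star \<theta>\<^sub>1 \<theta>\<^sub>2 (c *\<^sub>C x) = cnj c *\<^sub>C fermi_star \<theta>\<^sub>1 \<theta>\<^sub>2 x"
  unfolding fermi_star_def
   apply (rule tensor_lift_add[OF balanced_fermi_star[OF assms]])
  apply (simp only: tensor_lift_scaleC[OF balanced_fermi_star[OF assms]]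
      tensor_lift_fun_scaleC[symmetric])
  apply (simp add: graded_part_linear assms tensor_bilinear adj_scaleC scaleC_add_right
      scaleC_scaleC mult.commute)
  done

lemma fermi_star_homogeneous:
  assumes "grading \<theta>\<^sub>1" "grading \<theta>\<^sub>2" "homogeneous \<theta>\<^sub>1 s a\<^sub>1" "homogeneous \<theta>\<^sub>2 t a\<^sub>2"
  shows "fermi_star \<theta>\<^sub>1 \<theta>\<^sub>2 (a\<^sub>1 \<otimes> a\<^sub>2) = grade_sign s t *\<^sub>C (adj a\<^sub>1 \<otimes> adj a\<^sub>2)"
proof -
  have z: "0 \<otimes> b = 0" "a \<otimes> 0 = 0" for a :: 'a and b :: 'b
    using tensor_scaleC_left[of 0 0 b] tensor_scaleC_right[of a 0 0] by simp_all
  have adj0: "adj (0::'c::unital_cstar_algebra) = 0"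
    using adj_scaleC[of 0 "0::'c"] by simp
  have "s \<in> {1, - 1}" "t \<in> {1, - 1}"
    using assms(3,4) by (auto simp: homogeneous_def)
  then show ?thesis
    unfolding fermi_star_def tensor_lift_elem[OF balanced_fermi_star[OF assms(1,2)]]
    by (auto simp: graded_part_homogeneous[OF assms(3)] graded_part_homogeneous[OF assms(4)] z adj0)
qed

lemma balanced_fermi_grading:
  assumes "grading \<theta>\<^sub>1" "grading \<theta>\<^sub>2"
  shows "balanced (\<lambda>a\<^sub>1 a\<^sub>2. \<theta>\<^sub>1 a\<^sub>1 \<otimes> \<theta>\<^sub>2 a\<^sub>2)"
  by (rule balancedI) (simp_all add: grading_linear assms tensor_bilinear)

lemma fermi_grading_linear:
  assumes "grading \<theta>\<^sub>1" "grading \<theta>\<^sub>2"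
  shows "clinear (fermi_grading \<theta>\<^sub>1 \<theta>\<^sub>2)"
  by (simp add: clinear_iff fermi_grading_def tensor_lift_add[OF balanced_fermi_grading[OF assms]]
      tensor_lift_scaleC[OF balanced_fermi_grading[OF assms]] grading_linear assms
      tensor_bilinear tensor_lift_fun_scaleC)

lemma fermi_grading_elem:
  assumes "grading \<theta>\<^sub>1" "grading \<theta>\<^sub>2"
  shows "fermi_grading \<theta>\<^sub>1 \<theta>\<^sub>2 (a\<^sub>1 \<otimes> a\<^sub>2) = \<theta>\<^sub>1 a\<^sub>1 \<otimes> \<theta>\<^sub>2 a\<^sub>2"
  by (simp add: fermi_grading_def balanced_fermi_grading assms)

lemma balanced_product_functional:
  assumes "clinear \<omega>\<^sub>1" "clinear \<omega>\<^sub>2"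
  shows "balanced (\<lambda>a\<^sub>1 a\<^sub>2. \<omega>\<^sub>1 a\<^sub>1 * \<omega>\<^sub>2 a\<^sub>2 :: complex)"
  using assms[unfolded clinear_iff]
  by (intro balancedI) (simp_all add: scaleC_complex_def algebra_simps)

lemma product_functional_linear:
  assumes "clinear \<omega>\<^sub>1" "clinear \<omega>\<^sub>2"
  shows "clinear (product_functional \<omega>\<^sub>1 \<omega>\<^sub>2)"
proof -
  have "(\<lambda>a\<^sub>1 a\<^sub>2. \<omega>\<^sub>1 (c *\<^sub>C a\<^sub>1) * \<omega>\<^sub>2 a\<^sub>2) = (\<lambda>a\<^sub>1 a\<^sub>2. c *\<^sub>C (\<omega>\<^sub>1 a\<^sub>1 * \<omega>\<^sub>2 a\<^sub>2))" for c
    using assms(1)[unfolded clinear_iff] by (simp add: scaleC_complex_def mult.assoc)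
  then show ?thesis
    unfolding clinear_iff product_functional_def
    by (simp only: tensor_lift_add[OF balanced_product_functional[OF assms]]
        tensor_lift_scaleC[OF balanced_product_functional[OF assms]] tensor_lift_fun_scaleC
        simp_thms)
qed

lemma product_functional_elem:
  assumes "clinear \<omega>\<^sub>1" "clinear \<omega>\<^sub>2"
  shows "product_functional \<omega>\<^sub>1 \<omega>\<^sub>2 (a\<^sub>1 \<otimes> a\<^sub>2) = \<omega>\<^sub>1 a\<^sub>1 * \<omega>\<^sub>2 a\<^sub>2"
  by (simp add: product_functional_def balanced_product_functional assms)

end

theory Submission
  imports Defs
begin

text \<open>The sesquilinear form \<open>F(x, y) = (\<omega>\<^sub>1 \<times> \<omega>\<^sub>2)(x\<^sup>* y)\<close> is, on elementary tensors,
  \<open>\<omega>\<^sub>1(a\<^sub>1\<^sup>* b\<^sub>1) \<omega>\<^sub>2(p\<^sup>* b\<^sub>2) + \<omega>\<^sub>1(\<theta>\<^sub>1(a\<^sub>1\<^sup>* b\<^sub>1)) \<omega>\<^sub>2(q\<^sup>* b\<^sub>2)\<close>, where \<open>p\<close> and \<open>q\<close> are the even and the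
  odd part of \<open>a\<^sub>2\<close>. If \<open>\<omega>\<^sub>1\<close> is even, the two terms add up to \<open>\<omega>\<^sub>1(a\<^sub>1\<^sup>* b\<^sub>1) \<omega>\<^sub>2(a\<^sub>2\<^sup>* b\<^sub>2)\<close>; if \<open>\<omega>\<^sub>2\<close> is
  even, \<open>b\<^sub>2\<close> may be replaced by its even part in the first and its odd part in the second term. In
  either case \<open>F\<close> is a sum of products of positive semidefinite kernels, so that it is positive by
  the Schur product theorem. Conversely, a positive \<open>F\<close> is Hermitian; evaluated at \<open>1 \<otimes> 1\<close> and
  \<open>a \<otimes> b\<close> with \<open>a\<close> and \<open>b\<close> odd this says \<open>\<omega>\<^sub>1(a) \<omega>\<^sub>2(b) = - \<omega>\<^sub>1(a) \<omega>\<^sub>2(b)\<close>, so that one of the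
  functionals vanishes on all odd elements.\<close>

section \<open>Positive sesquilinear forms\<close>

definition sesquilinear :: "('v::complex_vector \<Rightarrow> 'v \<Rightarrow> complex) \<Rightarrow> bool"
  where "sesquilinear h \<longleftrightarrow>
    (\<forall>x y z. h (x + y) z = h x z + h y z) \<and> (\<forall>x y z. h x (y + z) = h x y + h x z) \<and>
    (\<forall>c x y. h (c *\<^sub>C x) y = cnj c * h x y) \<and> (\<forall>c x y. h x (c *\<^sub>C y) = c * h x y)"

definition positive_form :: "('v::complex_vector \<Rightarrow> 'v \<Rightarrow> complex) \<Rightarrow> bool"
  where "positive_form h \<longleftrightarrow> sesquilinear h \<and> (\<forall>x. 0 \<le> h x x)"

lemma sesquilinearD:
  assumes "sesquilinear h"
  shows "h (x + y) z = h x z + h y z" "h x (y + z) = h x y + h x z"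
    "h (c *\<^sub>C x) y = cnj c * h x y" "h x (c *\<^sub>C y) = c * h x y"
    "h 0 y = 0" "h x 0 = 0" "h (x - y) z = h x z - h y z" "h x (y - z) = h x y - h x z"
proof -
  note * = assms[unfolded sesquilinear_def, rule_format]
  show "h (x + y) z = h x z + h y z" "h x (y + z) = h x y + h x z"
    "h (c *\<^sub>C x) y = cnj c * h x y" "h x (c *\<^sub>C y) = c * h x y"
    using * by blast+
  show "h 0 y = 0" "h x 0 = 0"
    using assms[unfolded sesquilinear_def]
    by (metis complex_vector.scale_zero_left complex_cnj_zero mult_zero_left)+
  have "h ((x - y) + y) z = h (x - y) z + h y z" "h x ((y - z) + z) = h x (y - z) + h x z"
    using * by blast+
  then show "h (x - y) z = h x z - h y z" "h x (y - z) = h x y - h x z"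
    by simp_all
qed

lemma sesquilinear_sum:
  assumes "sesquilinear h"
  shows "h (\<Sum>i\<in>I. u i) (\<Sum>j\<in>J. v j) = (\<Sum>i\<in>I. \<Sum>j\<in>J. h (u i) (v j))"
proof -
  have r: "h x (\<Sum>j\<in>J. v j) = (\<Sum>j\<in>J. h x (v j))" for x
    by (induction J rule: infinite_finite_induct) (simp_all add: sesquilinearD[OF assms])
  show ?thesis
    by (induction I rule: infinite_finite_induct) (simp_all add: sesquilinearD[OF assms] r sum.distrib)
qed

lemma positive_form_compose:
  assumes "positive_form h" "clinear T"
  shows "positive_form (\<lambda>x y. h (T x) (T y))"
  using assms unfolding positive_form_def sesquilinear_def clinear_iff by simp

lemma positive_form_hermitian:
  assumes "positive_form h"
  shows "h y x = cnj (h x y)"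
proof -
  have s: "sesquilinear h" and Im0: "Im (h z z) = 0" for z
    using assms by (auto simp: positive_form_def less_eq_complex_def)
  have "h (x + y) (x + y) = h x x + h y y + (h x y + h y x)"
    "h (x + \<i> *\<^sub>C y) (x + \<i> *\<^sub>C y) = h x x + h y y + \<i> * (h x y - h y x)"
    by (simp_all add: sesquilinearD[OF s] algebra_simps)
  from this[THEN arg_cong[of _ _ Im]] show ?thesis
    by (simp add: Im0 complex_eq_iff)
qed

lemma positive_form_null:
  assumes "positive_form h" "h x x = 0"
  shows "h x y = 0"
proof (rule ccontr)
  assume nz: "h x y \<noteq> 0"
  have s: "sesquilinear h" and pos: "0 \<le> h z z" for z
    using assms by (auto simp: positive_form_def)
  define n where "n = (cmod (h x y))\<^sup>2"
  have n: "h x y * cnj (h x y) = complex_of_real n" "0 < n"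
    using nz by (simp_all add: n_def complex_norm_square del: of_real_power)
  define t where "t = (1 + Re (h y y)) / n"
  define c where "c = - (complex_of_real t * h x y)"
  have "h (y + c *\<^sub>C x) (y + c *\<^sub>C x) = h y y + c * cnj (h x y) + cnj c * h x y"
    using assms(2) positive_form_hermitian[OF assms(1), of y x]
    by (simp add: sesquilinearD[OF s])
  also have "\<dots> = h y y - 2 * complex_of_real t * (h x y * cnj (h x y))"
    by (simp add: c_def algebra_simps)
  also have "\<dots> = h y y - complex_of_real (2 * t * n)"
    by (simp add: n)
  finally have "0 \<le> Re (h y y) - 2 * t * n"
    using pos[of "y + c *\<^sub>C x"] by (simp add: less_eq_complex_def)
  also have "t * n = 1 + Re (h y y)"
    using n by (simp add: t_def)
  then have "Re (h y y) - 2 * t * n = - Re (h y y) - 2"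
    by (simp add: mult.assoc)
  finally show False
    using pos[of y] by (simp add: less_eq_complex_def)
qed

text \<open>Gram-Schmidt: subtracting from each vector its projection onto the vector \<open>a m\<close> splits off a
  rank-one summand and removes the index \<open>m\<close>. If \<open>h (a m) (a m) = 0\<close>, the coefficients \<open>c i\<close> are
  \<open>0\<close> by the convention on division, and the argument goes through since \<open>a m\<close> is then orthogonal to
  every vector.\<close>

lemma schur_product:
  assumes "positive_form h" "positive_form k" "finite I"
  shows "0 \<le> (\<Sum>i\<in>I. \<Sum>j\<in>I. h (a i) (a j) * k (b i) (b j))"
  using assms(3)
proof (induction I arbitrary: a rule: finite_induct)
  case empty
  then show ?case by simp
next
  case (insert m I)
  have s: "sesquilinear h" "sesquilinear k" and pos: "0 \<le> h x x" "0 \<le> k y y" for x y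
    using assms(1,2) by (auto simp: positive_form_def)
  note herm = positive_form_hermitian[OF assms(1)]
  define d where "d = h (a m) (a m)"
  define c where "c i = h (a m) (a i) / d" for i
  define a' where "a' i = a i - c i *\<^sub>C a m" for i
  have c: "h (a m) (a i) = d * c i" for i
    using positive_form_null[OF assms(1), of "a m" "a i"] by (cases "d = 0") (auto simp: c_def d_def)
  have d: "cnj d = d"
    using herm[of "a m" "a m"] by (simp add: d_def)
  have c': "h (a i) (a m) = d * cnj (c i)" for i
    using herm[of "a i" "a m"] by (simp add: c d)
  have proj: "d * c m = d" "d * cnj (c m) = d"
    using c[of m] c'[of m] by (simp_all flip: d_def)
  have split: "h (a i) (a j) = d * (c j * cnj (c i)) + h (a' i) (a' j)" for i j
    by (simp add: a'_def sesquilinearD[OF s(1)] c c' proj)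
  have "d = 0 \<or> c m = 1"
    by (auto simp: c_def d_def)
  then have z: "h (a' m) (a' j) = 0" "h (a' i) (a' m) = 0" for i j
    using split[of m j] split[of i m] unfolding c c' by auto
  let ?J = "insert m I" and ?v = "\<Sum>i\<in>insert m I. c i *\<^sub>C b i"
  have "(\<Sum>i\<in>?J. \<Sum>j\<in>?J. h (a i) (a j) * k (b i) (b j)) =
      d * (\<Sum>i\<in>?J. \<Sum>j\<in>?J. k (c i *\<^sub>C b i) (c j *\<^sub>C b j)) +
      (\<Sum>i\<in>?J. \<Sum>j\<in>?J. h (a' i) (a' j) * k (b i) (b j))"
    by (simp add: split distrib_right sum.distrib sum_distrib_left sesquilinearD[OF s(2)] mult.assoc
        del: sum.insert)
  also have "\<dots> = d * k ?v ?v + (\<Sum>i\<in>I. \<Sum>j\<in>I. h (a' i) (a' j) * k (b i) (b j))"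
    using insert.hyps by (simp only: sesquilinear_sum[OF s(2)]) (simp add: z)
  also have "0 \<le> \<dots>"
    using insert.IH[of a'] pos by (simp add: d_def)
  finally show ?case .
qed

section \<open>Gradings and states\<close>

lemma adj_one: "adj (1 :: 'a::unital_cstar_algebra) = 1"
  by (metis adj_adj adj_mult mult_1_left mult_1_right)

lemma gradingD:
  assumes "grading \<theta>"
  shows "\<theta> (a * b) = \<theta> a * \<theta> b" "\<theta> (adj a) = adj (\<theta> a)" "\<theta> (\<theta> a) = a" "clinear \<theta>"
  using assms by (auto simp: grading_def star_automorphism_def dest: fun_cong[of _ _ a])

lemma grading_one:
  assumes "grading \<theta>"
  shows "\<theta> 1 = 1"
  by (metis gradingD(1,3)[OF assms] mult_1_left mult_1_right)

lemma grading_diff: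
  assumes "grading \<theta>"
  shows "\<theta> (a - b) = \<theta> a - \<theta> b"
  using grading_linear(1)[OF assms, of "a - b" b] by simp

lemma graded_part_grading:
  assumes "grading \<theta>" "s \<in> {1, - 1}"
  shows "homogeneous \<theta> s (graded_part \<theta> s a)"
  using assms(2)
  by (auto simp: homogeneous_def graded_part_def grading_linear[OF assms(1)] gradingD(3)[OF assms(1)]
      scaleC_add_right scaleC_scaleC scaleC_one add.commute)

lemma graded_part_sum:
  "graded_part \<theta> 1 a + graded_part \<theta> (- 1) a = a"
proof -
  have "graded_part \<theta> 1 a + graded_part \<theta> (- 1) a = (1 / 2 + 1 / 2) *\<^sub>C a"
    by (simp only: scaleC_add_left)
      (simp add: graded_part_def scaleC_add_right scaleC_one complex_vector.scale_right_diff_distrib)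
  then show ?thesis by (simp add: scaleC_one)
qed

lemma graded_part_clinear:
  assumes "grading \<theta>"
  shows "clinear (graded_part \<theta> s)"
  by (simp add: clinear_iff graded_part_linear[OF assms])

lemma homogeneous_adj:
  assumes "grading \<theta>" "homogeneous \<theta> s a"
  shows "homogeneous \<theta> s (adj a)"
  using assms(2) by (auto simp: homogeneous_def gradingD(2)[OF assms(1)] adj_scaleC)

lemma homogeneous_mult:
  assumes "grading \<theta>" "homogeneous \<theta> s a" "homogeneous \<theta> t b"
  shows "homogeneous \<theta> (s * t) (a * b)"
  using assms(2,3)
  by (auto simp: homogeneous_def gradingD(1)[OF assms(1)] mult_scaleC_left mult_scaleC_right
      scaleC_scaleC)

lemma clinear_functionalD:
  fixes f :: "'v::complex_vector \<Rightarrow> complex"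
  assumes "clinear f"
  shows "f (x + y) = f x + f y" "f (c *\<^sub>C x) = c * f x"
  using assms unfolding clinear_iff by (simp_all add: scaleC_complex_def)

lemma even_functional_homogeneous:
  assumes "even_functional \<theta> f" "clinear f" "homogeneous \<theta> (- 1) a"
  shows "f a = 0"
proof -
  have "f a = f ((- 1) *\<^sub>C a)"
    using assms(1,3) by (metis even_functional_def homogeneous_def)
  then show ?thesis
    by (simp only: clinear_functionalD(2)[OF assms(2)]) simp
qed

lemma even_functionalI:
  assumes "grading \<theta>" "clinear f" "\<And>a. homogeneous \<theta> (- 1) a \<Longrightarrow> f a = 0"
  shows "even_functional \<theta> f"
  unfolding even_functional_def
proof
  fix a
  have "homogeneous \<theta> (- 1) (a - \<theta> a)"
    by (simp add: homogeneous_def grading_diff[OF assms(1)] gradingD(3)[OF assms(1)] scaleC_one)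
  then have "f (a - \<theta> a) = 0" by (rule assms(3))
  moreover have "f ((a - \<theta> a) + \<theta> a) = f (a - \<theta> a) + f (\<theta> a)"
    by (rule clinear_functionalD(1)[OF assms(2)])
  ultimately show "f (\<theta> a) = f a" by simp
qed

lemma stateD:
  assumes "state \<omega>"
  shows "clinear \<omega>" "\<omega> 1 = 1" "\<omega> (a + b) = \<omega> a + \<omega> b" "\<omega> (c *\<^sub>C a) = c * \<omega> a"
  using assms by (auto simp: state_def positive_functional_def clinear_functionalD)

lemma state_positive_form:
  assumes "state \<omega>"
  shows "positive_form (\<lambda>a b. \<omega> (adj a * b))"
  using assms
  by (auto simp: positive_form_def sesquilinear_def stateD[OF assms] adj_add adj_scaleC distrib_left
      distrib_right mult_scaleC_left mult_scaleC_right state_def positive_functional_def)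

lemma state_adj:
  assumes "state \<omega>"
  shows "\<omega> (adj a) = cnj (\<omega> a)"
  using positive_form_hermitian[OF state_positive_form[OF assms], of a 1]
  by (simp add: adj_one)

section \<open>The form of the product functional\<close>

lemma tensor_sum_elem:
  obtains I :: "nat set" and a b where "finite I" "x = (\<Sum>i\<in>I. a i \<otimes> b i)"
proof -
  have "\<exists>xs. x = (\<Sum>p\<leftarrow>xs. fst p \<otimes> snd p)"
  proof (induction x rule: tensor_induct)
    case (add x y)
    then obtain xs ys where "x = (\<Sum>p\<leftarrow>xs. fst p \<otimes> snd p)" "y = (\<Sum>p\<leftarrow>ys. fst p \<otimes> snd p)"
      by blast
    then show ?case by (intro exI[of _ "xs @ ys"]) simp
  next
    case (scaleC c x)
    then obtain xs where "x = (\<Sum>p\<leftarrow>xs. fst p \<otimes> snd p)" by blast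
    moreover have "c *\<^sub>C (\<Sum>p\<leftarrow>xs. fst p \<otimes> snd p) =
        (\<Sum>p\<leftarrow>map (\<lambda>p. (c *\<^sub>C fst p, snd p)) xs. fst p \<otimes> snd p)"
      by (induction xs) (simp_all add: scaleC_add_right tensor_scaleC_left)
    ultimately show ?case by blast
  next
    case (elem a b)
    show ?case by (intro exI[of _ "[(a, b)]"]) simp
  qed
  then obtain xs where "x = (\<Sum>p\<leftarrow>xs. fst p \<otimes> snd p)" by blast
  then have "x = (\<Sum>i\<in>{0..<length xs}. fst (xs ! i) \<otimes> snd (xs ! i))"
    by (simp add: sum_list_sum_nth)
  then show thesis
    by (rule that[rotated]) simp
qed

context
  fixes \<theta>\<^sub>1 :: "'a::unital_cstar_algebra \<Rightarrow> 'a" and \<theta>\<^sub>2 :: "'b::unital_cstar_algebra \<Rightarrow> 'b"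
    and \<omega>\<^sub>1 :: "'a \<Rightarrow> complex" and \<omega>\<^sub>2 :: "'b \<Rightarrow> complex"
  assumes gr: "grading \<theta>\<^sub>1" "grading \<theta>\<^sub>2" and st: "state \<omega>\<^sub>1" "state \<omega>\<^sub>2"
begin

definition fermi_form :: "('a, 'b) tensor \<Rightarrow> ('a, 'b) tensor \<Rightarrow> complex"
  where "fermi_form x y =
    product_functional \<omega>\<^sub>1 \<omega>\<^sub>2 (fermi_mult \<theta>\<^sub>1 \<theta>\<^sub>2 (fermi_star \<theta>\<^sub>1 \<theta>\<^sub>2 x) y)"

lemma sesquilinear_fermi_form: "sesquilinear fermi_form"
  using fermi_mult_linear[OF gr] product_functional_linear[OF stateD(1)[OF st(1)] stateD(1)[OF st(2)]]
  unfolding sesquilinear_def fermi_form_def clinear_iff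
  by (simp add: fermi_star_antilinear[OF gr] scaleC_complex_def)

lemma fermi_form_homogeneous:
  assumes "homogeneous \<theta>\<^sub>1 s a\<^sub>1" "homogeneous \<theta>\<^sub>2 t a\<^sub>2" "homogeneous \<theta>\<^sub>1 u b\<^sub>1"
  shows "fermi_form (a\<^sub>1 \<otimes> a\<^sub>2) (b\<^sub>1 \<otimes> b\<^sub>2) =
    grade_sign s t * grade_sign t u * (\<omega>\<^sub>1 (adj a\<^sub>1 * b\<^sub>1) * \<omega>\<^sub>2 (adj a\<^sub>2 * b\<^sub>2))"
proof -
  have "fermi_mult \<theta>\<^sub>1 \<theta>\<^sub>2 (fermi_star \<theta>\<^sub>1 \<theta>\<^sub>2 (a\<^sub>1 \<otimes> a\<^sub>2)) (b\<^sub>1 \<otimes> b\<^sub>2) =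
      (grade_sign s t * grade_sign t u) *\<^sub>C ((adj a\<^sub>1 * b\<^sub>1) \<otimes> (adj a\<^sub>2 * b\<^sub>2))"
    using fermi_mult_linear(1)[OF gr]
    by (simp add: fermi_star_homogeneous[OF gr assms(1,2)] clinear_iff scaleC_scaleC
        fermi_mult_homogeneous[OF gr homogeneous_adj[OF gr(2) assms(2)] assms(3)])
  then show ?thesis
    using product_functional_linear[OF stateD(1)[OF st(1)] stateD(1)[OF st(2)]]
    by (simp add: fermi_form_def clinear_functionalD
        product_functional_elem[OF stateD(1)[OF st(1)] stateD(1)[OF st(2)]])
qed

text \<open>For odd \<open>a\<^sub>2\<close> the sign in \<open>fermi_form_homogeneous\<close> is the grade of \<open>adj a\<^sub>1 * b\<^sub>1\<close>, hence it is
  produced by \<open>\<theta>\<^sub>1\<close>.\<close>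

lemma fermi_form_elem:
  "fermi_form (a\<^sub>1 \<otimes> a\<^sub>2) (b\<^sub>1 \<otimes> b\<^sub>2) =
    \<omega>\<^sub>1 (adj a\<^sub>1 * b\<^sub>1) * \<omega>\<^sub>2 (adj (graded_part \<theta>\<^sub>2 1 a\<^sub>2) * b\<^sub>2) +
    \<omega>\<^sub>1 (\<theta>\<^sub>1 (adj a\<^sub>1 * b\<^sub>1)) * \<omega>\<^sub>2 (adj (graded_part \<theta>\<^sub>2 (- 1) a\<^sub>2) * b\<^sub>2)"
proof -
  note form_add = sesquilinearD(1,2)[OF sesquilinear_fermi_form]
  note part = graded_part_grading[OF gr(1)] graded_part_grading[OF gr(2)]
  define p q where "p = graded_part \<theta>\<^sub>2 1 a\<^sub>2" and "q = graded_part \<theta>\<^sub>2 (- 1) a\<^sub>2"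
  define a a' where "a = graded_part \<theta>\<^sub>1 1 a\<^sub>1" and "a' = graded_part \<theta>\<^sub>1 (- 1) a\<^sub>1"
  define b b' where "b = graded_part \<theta>\<^sub>1 1 b\<^sub>1" and "b' = graded_part \<theta>\<^sub>1 (- 1) b\<^sub>1"
  have h: "homogeneous \<theta>\<^sub>2 1 p" "homogeneous \<theta>\<^sub>2 (- 1) q" "homogeneous \<theta>\<^sub>1 1 a"
    "homogeneous \<theta>\<^sub>1 (- 1) a'" "homogeneous \<theta>\<^sub>1 1 b" "homogeneous \<theta>\<^sub>1 (- 1) b'"
    by (simp_all add: p_def q_def a_def a'_def b_def b'_def part)
  have twist: "\<omega>\<^sub>1 (\<theta>\<^sub>1 (adj x * y)) = s * u * \<omega>\<^sub>1 (adj x * y)"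
    if "homogeneous \<theta>\<^sub>1 s x" "homogeneous \<theta>\<^sub>1 u y" for s u x y
    using homogeneous_mult[OF gr(1) homogeneous_adj[OF gr(1) that(1)] that(2)]
    by (simp only: homogeneous_def stateD(4)[OF st(1)])
  have eq: "a\<^sub>1 = a + a'" "a\<^sub>2 = p + q" "b\<^sub>1 = b + b'"
    by (simp_all add: p_def q_def a_def a'_def b_def b'_def graded_part_sum)
  show ?thesis
    unfolding p_def[symmetric] q_def[symmetric] unfolding eq
    by (simp add: tensor_add_left tensor_add_right form_add
        fermi_form_homogeneous[OF h(3) h(1) h(5)] fermi_form_homogeneous[OF h(3) h(1) h(6)]
        fermi_form_homogeneous[OF h(3) h(2) h(5)] fermi_form_homogeneous[OF h(3) h(2) h(6)]
        fermi_form_homogeneous[OF h(4) h(1) h(5)] fermi_form_homogeneous[OF h(4) h(1) h(6)]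
        fermi_form_homogeneous[OF h(4) h(2) h(5)] fermi_form_homogeneous[OF h(4) h(2) h(6)]
        twist[OF h(3) h(5)] twist[OF h(3) h(6)] twist[OF h(4) h(5)] twist[OF h(4) h(6)]
        grade_sign_def grading_linear[OF gr(1)] adj_add stateD(3)[OF st(1)] distrib_left distrib_right
        left_diff_distrib)
qed

lemma fermi_form_positive:
  assumes "positive_form h" "positive_form k" "positive_form h'" "positive_form k'"
    and "\<And>a b c d. fermi_form (a \<otimes> b) (c \<otimes> d) = h a c * k b d + h' a c * k' b d"
  shows "0 \<le> fermi_form x x"
proof -
  obtain I :: "nat set" and a b where I: "finite I" and x: "x = (\<Sum>i\<in>I. a i \<otimes> b i)"
    by (rule tensor_sum_elem)
  have "fermi_form x x = (\<Sum>i\<in>I. \<Sum>j\<in>I. h (a i) (a j) * k (b i) (b j)) +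
      (\<Sum>i\<in>I. \<Sum>j\<in>I. h' (a i) (a j) * k' (b i) (b j))"
    by (simp add: x sesquilinear_sum[OF sesquilinear_fermi_form] assms(5) sum.distrib)
  then show ?thesis
    using schur_product[OF assms(1,2) I, of a b] schur_product[OF assms(3,4) I, of a b] by simp
qed

lemma even_imp_positive_1:
  assumes "even_functional \<theta>\<^sub>1 \<omega>\<^sub>1"
  shows "0 \<le> fermi_form x x"
proof (rule fermi_form_positive)
  let ?h = "\<lambda>a c. \<omega>\<^sub>1 (adj a * c)" and ?k = "\<lambda>b d. \<omega>\<^sub>2 (adj b * d)" and ?z = "\<lambda>_ _. 0 :: complex"
  show "positive_form ?h" "positive_form ?k"
    by (rule state_positive_form[OF st(1)] state_positive_form[OF st(2)])+
  show "positive_form (?z :: 'a \<Rightarrow> 'a \<Rightarrow> complex)" "positive_form (?z :: 'b \<Rightarrow> 'b \<Rightarrow> complex)"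
    by (simp_all add: positive_form_def sesquilinear_def)
  fix a c and b d
  have "?k b d = \<omega>\<^sub>2 (adj (graded_part \<theta>\<^sub>2 1 b + graded_part \<theta>\<^sub>2 (- 1) b) * d)"
    by (simp add: graded_part_sum)
  then show "fermi_form (a \<otimes> b) (c \<otimes> d) = ?h a c * ?k b d + ?z a c * ?z b d"
    using assms
    by (simp add: fermi_form_elem even_functional_def adj_add distrib_right distrib_left stateD[OF st(2)])
qed

lemma even_imp_positive_2:
  assumes "even_functional \<theta>\<^sub>2 \<omega>\<^sub>2"
  shows "0 \<le> fermi_form x x"
proof (rule fermi_form_positive)
  let ?h = "\<lambda>a c. \<omega>\<^sub>1 (adj a * c)"
    and ?k = "\<lambda>s b d. \<omega>\<^sub>2 (adj (graded_part \<theta>\<^sub>2 s b) * graded_part \<theta>\<^sub>2 s d)"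
  show "positive_form ?h" "positive_form (\<lambda>a c. ?h (\<theta>\<^sub>1 a) (\<theta>\<^sub>1 c))"
    by (rule state_positive_form[OF st(1)]
        positive_form_compose[OF state_positive_form[OF st(1)] gradingD(4)[OF gr(1)]])+
  show "positive_form (?k 1)" "positive_form (?k (- 1))"
    by (rule positive_form_compose[OF state_positive_form[OF st(2)] graded_part_clinear[OF gr(2)]])+
  fix a c and b d
  have z: "\<omega>\<^sub>2 (adj (graded_part \<theta>\<^sub>2 s b) * graded_part \<theta>\<^sub>2 t d) = 0"
    if "s \<in> {1, - 1}" "t \<in> {1, - 1}" "s * t = - 1" for s t
    using homogeneous_mult[OF gr(2) homogeneous_adj[OF gr(2) graded_part_grading[OF gr(2) that(1)]]
        graded_part_grading[OF gr(2) that(2)]] that(3)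
    by (intro even_functional_homogeneous[OF assms stateD(1)[OF st(2)]]) simp
  have "\<omega>\<^sub>2 (adj (graded_part \<theta>\<^sub>2 s b) * d) = ?k s b d" if s: "s \<in> {1, - 1}" for s
  proof -
    have "\<omega>\<^sub>2 (adj (graded_part \<theta>\<^sub>2 s b) * (graded_part \<theta>\<^sub>2 1 d + graded_part \<theta>\<^sub>2 (- 1) d)) = ?k s b d"
      using s z[of s 1] z[of s "- 1"] by (auto simp: distrib_left stateD[OF st(2)])
    then show ?thesis by (simp only: graded_part_sum)
  qed
  then show "fermi_form (a \<otimes> b) (c \<otimes> d) = ?h a c * ?k 1 b d + ?h (\<theta>\<^sub>1 a) (\<theta>\<^sub>1 c) * ?k (- 1) b d"
    by (simp add: fermi_form_elem gradingD(1,2)[OF gr(1)])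
qed

lemma positive_imp_even:
  assumes "\<forall>x. 0 \<le> fermi_form x x"
  shows "even_functional \<theta>\<^sub>1 \<omega>\<^sub>1 \<or> even_functional \<theta>\<^sub>2 \<omega>\<^sub>2"
proof -
  have pos: "positive_form fermi_form"
    using assms by (simp add: positive_form_def sesquilinear_fermi_form)
  have one: "homogeneous \<theta>\<^sub>1 1 1" "homogeneous \<theta>\<^sub>2 1 1"
    by (simp_all add: homogeneous_def grading_one[OF gr(1)] grading_one[OF gr(2)] scaleC_one)
  have "\<omega>\<^sub>1 a * \<omega>\<^sub>2 b = 0" if h: "homogeneous \<theta>\<^sub>1 (- 1) a" "homogeneous \<theta>\<^sub>2 (- 1) b" for a b
  proof -
    have "fermi_form (1 \<otimes> 1) (a \<otimes> b) = \<omega>\<^sub>1 a * \<omega>\<^sub>2 b"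
      by (simp add: fermi_form_homogeneous[OF one h(1)] grade_sign_def adj_one)
    moreover have "fermi_form (a \<otimes> b) (1 \<otimes> 1) = - cnj (\<omega>\<^sub>1 a * \<omega>\<^sub>2 b)"
      by (simp add: fermi_form_homogeneous[OF h one(1)] grade_sign_def state_adj[OF st(1)]
          state_adj[OF st(2)])
    ultimately have "cnj (\<omega>\<^sub>1 a * \<omega>\<^sub>2 b) = - cnj (\<omega>\<^sub>1 a * \<omega>\<^sub>2 b)"
      using positive_form_hermitian[OF pos, of "a \<otimes> b" "1 \<otimes> 1"] by simp
    then have "cnj (\<omega>\<^sub>1 a * \<omega>\<^sub>2 b) = 0"
      by (simp only: eq_neg_iff_add_eq_0 flip: mult_2) simp
    then show ?thesis by simp
  qed
  then have "(\<forall>a. homogeneous \<theta>\<^sub>1 (- 1) a \<longrightarrow> \<omega>\<^sub>1 a = 0) \<or> (\<forall>b. homogeneous \<theta>\<^sub>2 (- 1) b \<longrightarrow> \<omega>\<^sub>2 b = 0)"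
    by (metis mult_eq_0_iff)
  then show ?thesis
    using even_functionalI[OF gr(1) stateD(1)[OF st(1)]] even_functionalI[OF gr(2) stateD(1)[OF st(2)]]
    by blast
qed

lemma positive_product_functional_iff:
  "positive_functional (fermi_mult \<theta>\<^sub>1 \<theta>\<^sub>2) (fermi_star \<theta>\<^sub>1 \<theta>\<^sub>2) (product_functional \<omega>\<^sub>1 \<omega>\<^sub>2) \<longleftrightarrow>
    even_functional \<theta>\<^sub>1 \<omega>\<^sub>1 \<or> even_functional \<theta>\<^sub>2 \<omega>\<^sub>2"
proof -
  have "positive_functional (fermi_mult \<theta>\<^sub>1 \<theta>\<^sub>2) (fermi_star \<theta>\<^sub>1 \<theta>\<^sub>2) (product_functional \<omega>\<^sub>1 \<omega>\<^sub>2) \<longleftrightarrow>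
      (\<forall>x. 0 \<le> fermi_form x x)"
    by (simp add: positive_functional_def fermi_form_def
        product_functional_linear[OF stateD(1)[OF st(1)] stateD(1)[OF st(2)]])
  also have "\<dots> \<longleftrightarrow> even_functional \<theta>\<^sub>1 \<omega>\<^sub>1 \<or> even_functional \<theta>\<^sub>2 \<omega>\<^sub>2"
    using even_imp_positive_1 even_imp_positive_2 positive_imp_even by metis
  finally show ?thesis .
qed

lemma even_product_functional_iff:
  "even_functional (fermi_grading \<theta>\<^sub>1 \<theta>\<^sub>2) (product_functional \<omega>\<^sub>1 \<omega>\<^sub>2) \<longleftrightarrow>
    even_functional \<theta>\<^sub>1 \<omega>\<^sub>1 \<and> even_functional \<theta>\<^sub>2 \<omega>\<^sub>2"
proof
  note elem = product_functional_elem[OF stateD(1)[OF st(1)] stateD(1)[OF st(2)]]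
    fermi_grading_elem[OF gr]
  {
    assume ev: "even_functional (fermi_grading \<theta>\<^sub>1 \<theta>\<^sub>2) (product_functional \<omega>\<^sub>1 \<omega>\<^sub>2)"
    have "\<omega>\<^sub>1 (\<theta>\<^sub>1 a) * \<omega>\<^sub>2 (\<theta>\<^sub>2 b) = \<omega>\<^sub>1 a * \<omega>\<^sub>2 b" for a b
      using ev[unfolded even_functional_def, rule_format, of "a \<otimes> b"] by (simp add: elem)
    from this[of _ 1] this[of 1] show "even_functional \<theta>\<^sub>1 \<omega>\<^sub>1 \<and> even_functional \<theta>\<^sub>2 \<omega>\<^sub>2"
      by (simp add: even_functional_def grading_one[OF gr(1)] grading_one[OF gr(2)]
          stateD[OF st(1)] stateD[OF st(2)])
  next
    assume ev: "even_functional \<theta>\<^sub>1 \<omega>\<^sub>1 \<and> even_functional \<theta>\<^sub>2 \<omega>\<^sub>2"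
    show "even_functional (fermi_grading \<theta>\<^sub>1 \<theta>\<^sub>2) (product_functional \<omega>\<^sub>1 \<omega>\<^sub>2)"
      unfolding even_functional_def
    proof
      fix x
      show "product_functional \<omega>\<^sub>1 \<omega>\<^sub>2 (fermi_grading \<theta>\<^sub>1 \<theta>\<^sub>2 x) = product_functional \<omega>\<^sub>1 \<omega>\<^sub>2 x"
        using ev fermi_grading_linear[OF gr]
          product_functional_linear[OF stateD(1)[OF st(1)] stateD(1)[OF st(2)]]
        by (induction x rule: tensor_induct) (simp_all add: clinear_iff elem even_functional_def)
    qed
  }
qed

end

theorem proposition2p6:
  fixes \<theta>\<^sub>1 :: "'a::unital_cstar_algebra \<Rightarrow> 'a" and \<theta>\<^sub>2 :: "'b::unital_cstar_algebra \<Rightarrow> 'b"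
    and \<omega>\<^sub>1 :: "'a \<Rightarrow> complex" and \<omega>\<^sub>2 :: "'b \<Rightarrow> complex"
  assumes "grading \<theta>\<^sub>1" and "grading \<theta>\<^sub>2"
    and "state \<omega>\<^sub>1" and "state \<omega>\<^sub>2"
  shows "(positive_functional (fermi_mult \<theta>\<^sub>1 \<theta>\<^sub>2) (fermi_star \<theta>\<^sub>1 \<theta>\<^sub>2) (product_functional \<omega>\<^sub>1 \<omega>\<^sub>2)
            \<longleftrightarrow> even_functional \<theta>\<^sub>1 \<omega>\<^sub>1 \<or> even_functional \<theta>\<^sub>2 \<omega>\<^sub>2) \<and>
         (even_functional (fermi_grading \<theta>\<^sub>1 \<theta>\<^sub>2) (product_functional \<omega>\<^sub>1 \<omega>\<^sub>2)
            \<longleftrightarrow> even_functional \<theta>\<^sub>1 \<omega>\<^sub>1 \<and> even_functional \<theta>\<^sub>2 \<omega>\<^sub>2)"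
  by (simp add: positive_product_functional_iff[OF assms] even_product_functional_iff[OF assms])

end
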